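(* Let $\mathbf{x}_\nu \in \mathbb{R}^n$, $\nu \in N$, be fixed linearly independent vectors, where $N$ is a finite set with $p := \#N < n - 1$, and let $\mathbb{V}_N := \mathrm{span}(\mathbf{x}_\nu : \nu \in N)$. Let $\mathbf{y}$ be a random vector in $\mathbb{R}^n$, let $\widehat{\mathbf{y}}$ be the orthogonal projection of $\mathbf{y}$ onto $\mathbb{V}_N$ and $\widehat{\boldsymbol{\epsilon}} := \mathbf{y} - \widehat{\mathbf{y}}$. Then the following three statements are equivalent: (i) For every fixed $\mathbf{S} \in \mathbb{O}_n(\mathbb{V}_N)$, $\mathcal{L}(\mathbf{S}\mathbf{y}) = \mathcal{L}(\mathbf{y})$. (ii) If $\mathbf{T}$ is a random matrix with distribution $\mathrm{Haar}_{n,\mathbb{V}_N}$ such that $\mathbf{y}$ and $\mathbf{T}$ are stochastically independent, then $\mathcal{L}(\mathbf{T}\mathbf{y}) = \mathcal{L}(\mathbf{y})$. (iii) If $\mathbf{u}$ is a random vector with uniform distribution on the unit sphere of $\mathbb{V}_N^\perp$ such that $\mathbf{y}$ and $\mathbf{u}$ are stochastically independent, then $\mathcal{L}(\mathbf{y}) = \mathcal{L}\bigl(\widehat{\mathbf{y}} + \|\widehat{\boldsymbol{\epsilon}}\| \mathbf{u}\bigr)$.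
   Context: $\mathcal{L}(\cdot)$ denotes the distribution (law) of a random object. $\mathbb{O}_n$ is the set of orthogonal $n\times n$ real matrices. For a linear subspace $\mathbb{V}$ of $\mathbb{R}^n$ with $\dim(\mathbb{V}) < n$, $\mathbb{O}_n(\mathbb{V}) := \{\mathbf{S} \in \mathbb{O}_n : \mathbf{S}\mathbf{v} = \mathbf{v} \text{ for all } \mathbf{v} \in \mathbb{V}\}$. Normalized Haar measure $\mathrm{Haar}_{n,\mathbb{V}}$ on $\mathbb{O}_n(\mathbb{V})$ is the unique probability distribution on $\mathbb{O}_n(\mathbb{V})$ such that a random matrix $\mathbf{T} \sim \mathrm{Haar}_{n,\mathbb{V}}$ satisfies $\mathcal{L}(\mathbf{S}\mathbf{T}) = \mathcal{L}(\mathbf{T})$ for every fixed $\mathbf{S} \in \mathbb{O}_n(\mathbb{V})$. $\mathbb{V}_N^\perp$ is the orthogonal complement of $\mathbb{V}_N$ in $\mathbb{R}^n$. *)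

theory Defs
  imports "HOL-Analysis.Analysis" "HOL-Probability.Probability"
begin

text \<open>The group O_n(V) of orthogonal n x n matrices fixing every vector of V.\<close>
definition orth_fix :: "(real^'n) set \<Rightarrow> (real^'n^'n) set" where
  "orth_fix V = {S. orthogonal_matrix S \<and> (\<forall>v\<in>V. S *v v = v)}"

text \<open>Normalized Haar measure on O_n(V): the unique probability distribution
  (on the Borel sets of the matrix space) concentrated on O_n(V) that is
  invariant under left multiplication by every fixed S in O_n(V).\<close>
definition Haar_fix :: "(real^'n) set \<Rightarrow> (real^'n^'n) measure" where
  "Haar_fix V = (THE \<mu>. sets \<mu> = sets borel \<and> prob_space \<mu> \<and> emeasure \<mu> (orth_fix V) = 1 \<and>
       (\<forall>S\<in>orth_fix V. distr \<mu> borel (\<lambda>T. S ** T) = \<mu>))"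

text \<open>Uniform distribution on the unit sphere of the subspace W: the unique
  probability distribution concentrated on the unit sphere of W that is invariant
  under every orthogonal map of the ambient space preserving W pointwise-orthogonally,
  i.e. under every S in O_n(W^perp) (the rotations of W).\<close>
definition unif_sphere :: "(real^'n) set \<Rightarrow> (real^'n) measure" where
  "unif_sphere W = (THE \<mu>. sets \<mu> = sets borel \<and> prob_space \<mu> \<and>
       emeasure \<mu> (W \<inter> sphere 0 1) = 1 \<and>
       (\<forall>S\<in>orth_fix (orthogonal_comp W). distr \<mu> borel (\<lambda>u. S *v u) = \<mu>))"

text \<open>Orthogonal projection of v onto the subspace V.\<close>
definition orth_proj :: "(real^'n) set \<Rightarrow> real^'n \<Rightarrow> real^'n" where
  "orth_proj V v = (THE w. w \<in> V \<and> v - w \<in> orthogonal_comp V)"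

end

theory Submission
  imports Defs
begin

text \<open>The Haar measure on O_n(V) is built by induction on the codimension of V: if T is Haar
  distributed on O_n(span (insert e V)) for a unit vector e of the complement and u is an
  independent rotation-invariant random unit vector of the complement (the normalised residual of
  a uniform point of the unit ball), then H T is Haar distributed on O_n(V), where H is the
  Householder reflection exchanging e and u. Uniqueness and right invariance follow from Fubini
  applied to S T with S distributed as the transpose of one Haar measure and T as another.
  For a fixed v and Haar distributed T, T v = P v + \<parallel>v - P v\<parallel> T e' with e' a unit vector of the
  complement, and T e' is uniform on its unit sphere; so the law in (iii) is the Haar average of
  the law of y in (ii). By Fubini again, this average equals the law of y exactly when that law
  is O_n(V)-invariant.\<close>

section \<open>Lebesgue measure is invariant under orthogonal matrices\<close>

text \<open>The library proves invariance of Lebesgue measure under orthogonal maps only for index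
  types of class \<^class>\<open>wellorder\<close>; a copy of an arbitrary finite index type, ordered via
  \<^const>\<open>to_nat\<close>, transfers it to every \<^typ>\<open>real^'n\<close>.\<close>

typedef 'n wellordered = "UNIV :: 'n set" by simp

instance wellordered :: (finite) finite
  by standard (metis finite_imageI finite type_definition.univ type_definition_wellordered)

instantiation wellordered :: (finite) wellorder
begin

definition less_eq_wellordered :: "'a wellordered \<Rightarrow> 'a wellordered \<Rightarrow> bool"
  where "x \<le> y \<longleftrightarrow> to_nat (Rep_wellordered x) \<le> to_nat (Rep_wellordered y)"

definition less_wellordered :: "'a wellordered \<Rightarrow> 'a wellordered \<Rightarrow> bool"
  where "x < y \<longleftrightarrow> to_nat (Rep_wellordered x) < to_nat (Rep_wellordered y)"

instance
proof
  fix P :: "'a wellordered \<Rightarrow> bool" and a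
  assume step: "\<And>x. (\<And>y. y < x \<Longrightarrow> P y) \<Longrightarrow> P x"
  have "\<forall>x. to_nat (Rep_wellordered x) = n \<longrightarrow> P x" for n
    by (induction n rule: less_induct) (use step in \<open>auto simp: less_wellordered_def\<close>)
  then show "P a" by blast
next
  fix x y z :: "'a wellordered"
  show "x < y \<longleftrightarrow> x \<le> y \<and> \<not> y \<le> x" "x \<le> x" "x \<le> y \<or> y \<le> x"
    by (auto simp: less_eq_wellordered_def less_wellordered_def)
  show "x \<le> y \<Longrightarrow> y \<le> z \<Longrightarrow> x \<le> z"
    by (auto simp: less_eq_wellordered_def)
  show "x \<le> y \<Longrightarrow> y \<le> x \<Longrightarrow> x = y"
    by (auto simp: less_eq_wellordered_def Rep_wellordered_inject)
qed

end

lemma linear_imp_borel_measurable: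
  fixes f :: "'a::euclidean_space \<Rightarrow> 'b::euclidean_space"
  assumes "linear f"
  shows "f \<in> borel_measurable borel"
  using assms
  by (intro borel_measurable_continuous_onI linear_continuous_on linear_conv_bounded_linear[THEN iffD1])

lemma distr_lborel_orthogonal_transformation_wellorder:
  fixes f :: "real^'m::{finite,wellorder} \<Rightarrow> real^'m::{finite,wellorder}"
  assumes f: "orthogonal_transformation f"
  shows "distr lborel borel f = lborel"
proof (rule lborel_eqI[symmetric])
  have "continuous_on UNIV f"
    using f by (simp add: orthogonal_transformation_linear linear_continuous_on linear_linear)
  then have f_meas: "f \<in> borel_measurable borel" and f_open: "open (f -` box l u)" for l u
    using open_vimage[of "box l u" f] by (auto intro: borel_measurable_continuous_onI)
  have g: "orthogonal_transformation (inv f)"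
    using f by (simp add: orthogonal_transformation_inv)
  have pre: "f -` X = inv f ` X" for X
    using f by (simp add: orthogonal_transformation_bij bij_vimage_eq_inv_image)
  fix l u :: "real^'m::{finite,wellorder}" assume le: "\<And>b. b \<in> Basis \<Longrightarrow> l \<bullet> b \<le> u \<bullet> b"
  have bd: "bounded (inv f ` box l u)"
    using g by (simp add: bounded_linear_image orthogonal_transformation_linear linear_linear)
  have "emeasure (distr lborel borel f) (box l u) = emeasure lebesgue (f -` box l u)"
    using f_meas f_open by (simp add: emeasure_distr emeasure_completion borel_open)
  also have "\<dots> = ennreal (measure lebesgue (inv f ` box l u))"
    using bd f_open unfolding pre by (metis emeasure_eq_measure2 fmeasurableD2 lmeasurable_open pre)
  also have "\<dots> = ennreal (measure lebesgue (box l u))"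
    using measure_orthogonal_image[OF g] by simp
  also have "\<dots> = emeasure lborel (box l u)"
    by (metis emeasure_eq_measure2 fmeasurable_box measure_completion sets_lborel box_borel)
  also have "\<dots> = (\<Prod>b\<in>Basis. (u - l) \<bullet> b)"
    using le by (simp add: emeasure_lborel_box_eq inner_diff_left)
  finally show "emeasure (distr lborel borel f) (box l u) = (\<Prod>b\<in>Basis. (u - l) \<bullet> b)" .
qed simp

definition to_wellordered :: "real^'n \<Rightarrow> real^'n wellordered"
  where "to_wellordered x = (\<chi> i. x $ Rep_wellordered i)"

definition of_wellordered :: "real^'n wellordered \<Rightarrow> real^'n"
  where "of_wellordered y = (\<chi> j. y $ Abs_wellordered j)"

lemma to_of_wellordered [simp]: "to_wellordered (of_wellordered y) = y"
  and of_to_wellordered [simp]: "of_wellordered (to_wellordered x) = x"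
  by (auto simp: to_wellordered_def of_wellordered_def vec_eq_iff
      Rep_wellordered_inverse Abs_wellordered_inverse)

lemma linear_to_wellordered: "linear to_wellordered"
  and linear_of_wellordered: "linear of_wellordered"
  by (auto simp: linear_iff to_wellordered_def of_wellordered_def vec_eq_iff)

lemma bij_Rep_wellordered: "bij Rep_wellordered"
  by (rule bij_betw_byWitness[where f' = Abs_wellordered])
    (auto simp: Rep_wellordered_inverse Abs_wellordered_inverse)

lemma bij_Abs_wellordered: "bij Abs_wellordered"
  by (rule bij_betw_byWitness[where f' = Rep_wellordered])
    (auto simp: Rep_wellordered_inverse Abs_wellordered_inverse)

lemma inner_to_wellordered [simp]: "to_wellordered x \<bullet> to_wellordered y = x \<bullet> y"
  unfolding inner_vec_def to_wellordered_def vec_lambda_beta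
  by (rule sum.reindex_bij_betw[OF bij_Rep_wellordered, of "\<lambda>j. x $ j \<bullet> y $ j"])

lemma inner_of_wellordered [simp]: "of_wellordered x \<bullet> of_wellordered y = x \<bullet> y"
  using inner_to_wellordered[of "of_wellordered x" "of_wellordered y"] by simp

lemma all_wellordered: "(\<forall>i. P i) \<longleftrightarrow> (\<forall>j. P (Abs_wellordered j))"
  by (metis Abs_wellordered_cases)

lemma prod_Basis_vec: "(\<Prod>b\<in>(Basis::(real^'n) set). h b) = (\<Prod>i\<in>UNIV. h (axis i 1))"
proof -
  have Basis: "(Basis::(real^'n) set) = range (\<lambda>i. axis i 1)"
    by (auto simp: Basis_vec_def)
  have "inj (\<lambda>i::'n. axis i (1::real))"
    by (auto simp: inj_on_def axis_eq_axis)
  then show ?thesis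
    unfolding Basis by (simp add: prod.reindex)
qed

lemma distr_lborel_to_wellordered: "distr lborel borel (to_wellordered :: real^'n \<Rightarrow> _) = lborel"
proof (rule lborel_eqI[symmetric])
  fix l u :: "real^'n wellordered" assume le: "\<And>b. b \<in> Basis \<Longrightarrow> l \<bullet> b \<le> u \<bullet> b"
  have pre: "(to_wellordered :: real^'n \<Rightarrow> _) -` box l u = box (of_wellordered l) (of_wellordered u)"
    unfolding set_eq_iff vimage_eq mem_box_cart to_wellordered_def of_wellordered_def
      vec_lambda_beta all_wellordered
    by (simp add: Abs_wellordered_inverse)
  have le': "of_wellordered l $ i \<le> of_wellordered u $ i" for i
    using le[of "axis (Abs_wellordered i) 1"] by (auto simp: of_wellordered_def Basis_vec_def inner_axis)
  have "emeasure (distr lborel borel (to_wellordered :: real^'n \<Rightarrow> _)) (box l u)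
      = emeasure lborel (box (of_wellordered l) (of_wellordered u))"
    using linear_imp_borel_measurable[OF linear_to_wellordered] pre
    by (subst emeasure_distr) auto
  also have "\<dots> = (\<Prod>b\<in>Basis. (of_wellordered u - of_wellordered l) \<bullet> b)"
    using le' by (subst emeasure_lborel_box_eq)
      (auto simp: Basis_vec_def cart_eq_inner_axis inner_commute)
  also have "\<dots> = (\<Prod>j\<in>UNIV. (u - l) $ Abs_wellordered j)"
    by (simp add: prod_Basis_vec inner_axis of_wellordered_def)
  also have "\<dots> = (\<Prod>b\<in>Basis. (u - l) \<bullet> b)"
    using prod.reindex_bij_betw[OF bij_Abs_wellordered, of "\<lambda>i. (u - l) $ i"]
    by (simp add: prod_Basis_vec inner_axis)
  finally show "emeasure (distr lborel borel (to_wellordered :: real^'n \<Rightarrow> _)) (box l u)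
      = (\<Prod>b\<in>Basis. (u - l) \<bullet> b)" .
qed simp

lemma distr_lborel_orthogonal_matrix:
  fixes S :: "real^'n^'n"
  assumes S: "orthogonal_matrix S"
  shows "distr lborel borel ((*v) S) = lborel"
proof -
  define f where "f = to_wellordered \<circ> (*v) S \<circ> of_wellordered"
  have "orthogonal_transformation ((*v) S)"
    using S by (simp add: orthogonal_transformation_matrix)
  then have "orthogonal_transformation f"
    unfolding f_def orthogonal_transformation_def
    by (auto intro!: linear_compose linear_of_wellordered linear_to_wellordered)
  have meas: "to_wellordered \<in> borel_measurable (borel :: (real^'n) measure)"
    "of_wellordered \<in> borel_measurable (borel :: (real^'n wellordered) measure)"
    "f \<in> borel_measurable borel"
    using \<open>orthogonal_transformation f\<close>
    by (auto intro!: linear_imp_borel_measurable linear_to_wellordered linear_of_wellordered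
        orthogonal_transformation_linear)
  have "distr lborel borel (of_wellordered :: _ \<Rightarrow> real^'n)
      = distr (distr lborel borel to_wellordered) borel of_wellordered"
    by (simp add: distr_lborel_to_wellordered)
  also have "\<dots> = lborel"
    using meas by (simp add: distr_distr o_def distr_id2)
  finally have of_lborel: "distr lborel borel (of_wellordered :: _ \<Rightarrow> real^'n) = lborel" .
  have "(*v) S = of_wellordered \<circ> f \<circ> to_wellordered"
    by (auto simp: f_def)
  then have "distr lborel borel ((*v) S)
      = distr (distr (distr lborel borel to_wellordered) borel f) borel of_wellordered"
    using meas by (simp add: distr_distr comp_assoc)
  also have "\<dots> = lborel"
    by (simp add: distr_lborel_to_wellordered
        distr_lborel_orthogonal_transformation_wellorder[OF \<open>orthogonal_transformation f\<close>] of_lborel)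
  finally show ?thesis .
qed

section \<open>Orthogonal projection and the group O_n(V)\<close>

lemma orth_proj_unique:
  fixes V :: "(real^'n) set"
  assumes V: "subspace V" and w: "w \<in> V" "v - w \<in> orthogonal_comp V"
  shows "orth_proj V v = w"
  unfolding orth_proj_def
proof (rule the_equality)
  show "w \<in> V \<and> v - w \<in> orthogonal_comp V" using w by blast
  fix w' assume w': "w' \<in> V \<and> v - w' \<in> orthogonal_comp V"
  have "w' - w \<in> V" using V w w' by (simp add: subspace_diff)
  moreover have "w' - w = (v - w) - (v - w')" by simp
  then have "w' - w \<in> orthogonal_comp V"
    using w w' subspace_diff[OF subspace_orthogonal_comp] by metis
  ultimately have "w' - w = 0" using orthogonal_Int_0[OF V] by blast
  then show "w' = w" by simp
qed

lemma
  fixes V :: "(real^'n) set"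
  assumes V: "subspace V"
  shows orth_proj_in_subspace: "orth_proj V v \<in> V"
    and orth_proj_residual_orthogonal: "v - orth_proj V v \<in> orthogonal_comp V"
proof -
  obtain a b where ab: "a \<in> V" "b \<in> orthogonal_comp V" "v = a + b"
    using subspace_sum_orthogonal_comp[OF V] set_plus_elim by (metis UNIV_I)
  then have "orth_proj V v = a" by (intro orth_proj_unique[OF V]) auto
  then show "orth_proj V v \<in> V" "v - orth_proj V v \<in> orthogonal_comp V" using ab by auto
qed

lemma linear_orth_proj:
  fixes V :: "(real^'n) set"
  assumes V: "subspace V"
  shows "linear (orth_proj V)"
proof -
  note proj = orth_proj_in_subspace[OF V] orth_proj_residual_orthogonal[OF V]
  have "orth_proj V (a + b) = orth_proj V a + orth_proj V b" for a b
  proof (rule orth_proj_unique[OF V])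
    show "orth_proj V a + orth_proj V b \<in> V" using proj V by (simp add: subspace_add)
    have "a + b - (orth_proj V a + orth_proj V b) = (a - orth_proj V a) + (b - orth_proj V b)"
      by simp
    then show "a + b - (orth_proj V a + orth_proj V b) \<in> orthogonal_comp V"
      using proj subspace_add[OF subspace_orthogonal_comp] by metis
  qed
  moreover have "orth_proj V (c *\<^sub>R a) = c *\<^sub>R orth_proj V a" for c a
  proof (rule orth_proj_unique[OF V])
    show "c *\<^sub>R orth_proj V a \<in> V" using proj V by (simp add: subspace_scale)
    have "c *\<^sub>R a - c *\<^sub>R orth_proj V a = c *\<^sub>R (a - orth_proj V a)" by (simp add: algebra_simps)
    then show "c *\<^sub>R a - c *\<^sub>R orth_proj V a \<in> orthogonal_comp V"
      using proj subspace_scale[OF subspace_orthogonal_comp] by metis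
  qed
  ultimately show ?thesis by (simp add: linear_iff)
qed

lemma unit_vector_in_orthogonal_comp:
  fixes V :: "(real^'n) set"
  assumes V: "subspace V" "V \<noteq> UNIV"
  obtains e where "e \<in> orthogonal_comp V" "norm e = 1"
proof -
  obtain x where x: "x \<notin> V" using V(2) by auto
  define b where "b = x - orth_proj V x"
  have "b \<in> orthogonal_comp V"
    unfolding b_def by (rule orth_proj_residual_orthogonal[OF V(1)])
  then have "sgn b \<in> orthogonal_comp V"
    unfolding sgn_div_norm by (rule subspace_scale[OF subspace_orthogonal_comp])
  moreover have "b \<noteq> 0"
    unfolding b_def using x orth_proj_in_subspace[OF V(1), of x] by (metis eq_iff_diff_eq_0)
  ultimately show ?thesis using that by (simp add: norm_sgn)
qed

lemma inner_orthogonal_matrix: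
  fixes S :: "real^'n^'n"
  assumes "orthogonal_matrix S"
  shows "(S *v a) \<bullet> (S *v b) = a \<bullet> b"
proof -
  have "orthogonal_transformation ((*v) S)"
    using assms by (simp add: orthogonal_transformation_matrix)
  then show ?thesis by (simp add: orthogonal_transformation_def)
qed

lemma norm_orthogonal_matrix:
  fixes S :: "real^'n^'n"
  assumes "orthogonal_matrix S"
  shows "norm (S *v a) = norm a"
  using inner_orthogonal_matrix[OF assms, of a a] by (simp add: norm_eq_sqrt_inner)

lemma sgn_orthogonal_matrix:
  fixes S :: "real^'n^'n"
  assumes "orthogonal_matrix S"
  shows "S *v sgn x = sgn (S *v x)"
  using norm_orthogonal_matrix[OF assms, of x] by (simp add: sgn_div_norm matrix_vector_mult_scaleR)

lemma orth_fix_orthogonal_matrix: "S \<in> orth_fix V \<Longrightarrow> orthogonal_matrix S"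
  and orth_fix_fixes: "S \<in> orth_fix V \<Longrightarrow> v \<in> V \<Longrightarrow> S *v v = v"
  by (auto simp: orth_fix_def)

lemma orth_fix_orthogonal_comp:
  assumes S: "S \<in> orth_fix V" and w: "w \<in> orthogonal_comp V"
  shows "S *v w \<in> orthogonal_comp V"
proof -
  have "v \<bullet> (S *v w) = 0" if "v \<in> V" for v
  proof -
    have "v \<bullet> (S *v w) = (S *v v) \<bullet> (S *v w)" using orth_fix_fixes[OF S that] by simp
    also have "\<dots> = v \<bullet> w" by (rule inner_orthogonal_matrix[OF orth_fix_orthogonal_matrix[OF S]])
    also have "\<dots> = 0" using w that by (simp add: orthogonal_comp_def orthogonal_def)
    finally show ?thesis .
  qed
  then show ?thesis by (simp add: orthogonal_comp_def orthogonal_def)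
qed

lemma orth_proj_orth_fix:
  fixes V :: "(real^'n) set"
  assumes V: "subspace V" and S: "S \<in> orth_fix V"
  shows "orth_proj V (S *v v) = orth_proj V v"
proof (rule orth_proj_unique[OF V])
  show "orth_proj V v \<in> V" by (rule orth_proj_in_subspace[OF V])
  have "S *v v - orth_proj V v = S *v (v - orth_proj V v)"
    using orth_fix_fixes[OF S orth_proj_in_subspace[OF V]]
    by (simp add: matrix_vector_mult_diff_distrib)
  then show "S *v v - orth_proj V v \<in> orthogonal_comp V"
    using orth_fix_orthogonal_comp[OF S orth_proj_residual_orthogonal[OF V]] by simp
qed

lemma orth_fix_mult: "S \<in> orth_fix V \<Longrightarrow> T \<in> orth_fix V \<Longrightarrow> S ** T \<in> orth_fix V"
  by (auto simp: orth_fix_def orthogonal_matrix_mul matrix_vector_mul_assoc[symmetric])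

lemma orth_fix_transpose:
  fixes S :: "real^'n^'n"
  assumes S: "S \<in> orth_fix V"
  shows "transpose S \<in> orth_fix V"
proof -
  have "transpose S ** S = mat 1"
    using orth_fix_orthogonal_matrix[OF S] by (simp add: orthogonal_matrix_def)
  then have "transpose S *v v = v" if "v \<in> V" for v
    using orth_fix_fixes[OF S that] by (metis matrix_vector_mul_assoc matrix_vector_mul_lid)
  then show ?thesis using orth_fix_orthogonal_matrix[OF S] by (auto simp: orth_fix_def)
qed

lemma orth_fix_antimono: "V \<subseteq> V' \<Longrightarrow> orth_fix V' \<subseteq> orth_fix V"
  by (auto simp: orth_fix_def)

lemma orth_fix_UNIV: "orth_fix (UNIV :: (real^'n) set) = {mat 1}"
  by (auto simp: orth_fix_def orthogonal_matrix_id matrix_eq)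

lemma continuous_on_matrix_mult [continuous_intros]:
  fixes f g :: "'a::topological_space \<Rightarrow> real^'n^'n"
  assumes "continuous_on A f" "continuous_on A g"
  shows "continuous_on A (\<lambda>x. f x ** g x)"
  unfolding matrix_matrix_mult_def by (intro continuous_intros assms)

lemma continuous_on_matrix_vector_mult [continuous_intros]:
  fixes f :: "'a::topological_space \<Rightarrow> real^'n^'n" and g :: "'a \<Rightarrow> real^'n"
  assumes "continuous_on A f" "continuous_on A g"
  shows "continuous_on A (\<lambda>x. f x *v g x)"
  unfolding matrix_vector_mult_def by (intro continuous_intros assms)

lemma continuous_on_transpose [continuous_intros]:
  fixes f :: "'a::topological_space \<Rightarrow> real^'n^'n"
  assumes "continuous_on A f"
  shows "continuous_on A (\<lambda>x. transpose (f x))"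
  unfolding transpose_def by (intro continuous_intros assms)

lemma closed_orth_fix: "closed (orth_fix (V :: (real^'n) set))"
proof -
  have "orth_fix V = {S. transpose S ** S = mat 1} \<inter> {S. S ** transpose S = mat 1}
      \<inter> (\<Inter>v\<in>V. {S. S *v v = v})"
    by (auto simp: orth_fix_def orthogonal_matrix_def)
  then show ?thesis
    by (simp only:) (intro closed_Int closed_INT closed_Collect_eq continuous_intros ballI)
qed

lemma orth_fix_borel [measurable]: "orth_fix (V :: (real^'n) set) \<in> sets borel"
  by (rule borel_closed[OF closed_orth_fix])

section \<open>Householder reflections\<close>

definition householder :: "real^'n \<Rightarrow> real^'n \<Rightarrow> real^'n^'n" where
  "householder e u = (\<chi> i j. (if i = j then 1 else 0) - 2 / ((e - u) \<bullet> (e - u)) * (e - u) $ i * (e - u) $ j)"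

lemma householder_apply:
  "householder e u *v x = x - (2 / ((e - u) \<bullet> (e - u)) * ((e - u) \<bullet> x)) *\<^sub>R (e - u)"
proof -
  have "(\<chi> i j. (if i = j then 1 else 0) - c * w $ i * w $ j) *v x = x - (c * (w \<bullet> x)) *\<^sub>R w"
    for c w
  proof -
    have "(\<Sum>j\<in>UNIV. ((if i = j then 1 else 0) - c * w $ i * w $ j) * x $ j)
        = (\<Sum>j\<in>UNIV. (if i = j then x $ j else 0) - c * w $ i * (w $ j * x $ j))" for i
      by (rule sum.cong) (auto simp: algebra_simps)
    also have "\<dots> i = x $ i - c * (w \<bullet> x) * w $ i" for i
      by (simp add: sum_subtractf sum_distrib_left inner_vec_def mult_ac)
    finally show ?thesis
      by (simp add: vec_eq_iff matrix_vector_mult_def)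
  qed
  then show ?thesis
    unfolding householder_def .
qed

lemma reflection_involutive:
  fixes w x :: "'a::real_inner"
  defines "r \<equiv> \<lambda>x. x - (2 / (w \<bullet> w) * (w \<bullet> x)) *\<^sub>R w"
  shows "r (r x) = x"
proof (cases "w = 0")
  case False
  then have "w \<bullet> r x = - (w \<bullet> x)"
    by (simp add: r_def inner_diff_right)
  then show ?thesis by (simp add: r_def algebra_simps)
qed (simp add: r_def)

lemma householder_involutive: "householder e u ** householder e u = mat 1"
proof -
  have "householder e u *v (householder e u *v x) = x" for x
    unfolding householder_apply using reflection_involutive[where w = "e - u" and x = x] by simp
  then show ?thesis by (simp add: matrix_eq matrix_vector_mul_assoc)
qed

lemma orthogonal_matrix_householder: "orthogonal_matrix (householder e u)"
proof -
  have "householder e u $ i $ j = householder e u $ j $ i" for i j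
    unfolding householder_def vec_lambda_beta by (cases "i = j") (simp_all add: algebra_simps)
  then have "transpose (householder e u) = householder e u"
    by (simp add: transpose_def vec_eq_iff)
  then show ?thesis
    by (simp add: orthogonal_matrix_def householder_involutive)
qed

lemma householder_maps:
  assumes "norm e = norm u"
  shows "householder e u *v e = u"
proof (cases "e = u")
  case False
  have "e \<bullet> e = u \<bullet> u" using assms by (simp add: dot_square_norm)
  then have ww: "(e - u) \<bullet> (e - u) = 2 * ((e - u) \<bullet> e)"
    by (simp add: inner_diff_left inner_diff_right inner_commute)
  moreover have "(e - u) \<bullet> (e - u) \<noteq> 0" using False by simp
  ultimately have "2 / ((e - u) \<bullet> (e - u)) * ((e - u) \<bullet> e) = 1" by simp
  then show ?thesis by (simp only: householder_apply) simp
qed (simp add: householder_apply)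

lemma householder_maps_back:
  assumes "norm e = norm u"
  shows "householder e u *v u = e"
  by (metis assms householder_maps householder_involutive matrix_vector_mul_assoc
      matrix_vector_mul_lid)

lemma householder_orth_fix:
  assumes "e \<in> orthogonal_comp V" "u \<in> orthogonal_comp V"
  shows "householder e u \<in> orth_fix V"
proof -
  have "householder e u *v v = v" if "v \<in> V" for v
  proof -
    have "e \<bullet> v = 0" "u \<bullet> v = 0"
      using assms that by (auto simp: orthogonal_comp_def orthogonal_def inner_commute)
    then have "(e - u) \<bullet> v = 0"
      by (simp add: inner_diff_left)
    then show ?thesis by (simp add: householder_apply)
  qed
  then show ?thesis
    by (simp add: orth_fix_def orthogonal_matrix_householder)
qed

lemma borel_measurable_householder [measurable (raw)]:
  fixes f :: "'a \<Rightarrow> real^'n"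
  assumes "f \<in> borel_measurable M"
  shows "(\<lambda>x. householder e (f x)) \<in> borel_measurable M"
proof -
  have "householder e = (\<lambda>u. mat 1 - (2 / ((e - u) \<bullet> (e - u))) *\<^sub>R (\<chi> i j. (e - u) $ i * (e - u) $ j))"
    by (simp add: householder_def fun_eq_iff vec_eq_iff mat_def mult.assoc)
  also have "\<dots> \<in> borel_measurable borel"
    by (intro borel_measurable_diff borel_measurable_const borel_measurable_scaleR
        borel_measurable_divide borel_measurable_continuous_onI continuous_intros)
  finally have "householder e \<in> borel_measurable borel" .
  from measurable_compose[OF assms this] show ?thesis
    by (simp add: comp_def)
qed

section \<open>Push-forwards of product measures\<close>

lemma space_eq_UNIV_if_sets_eq_borel: "sets \<mu> = sets borel \<Longrightarrow> space \<mu> = UNIV"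
  by (metis sets_eq_imp_space_eq space_borel)

lemma measurable_if_sets_eq_borel:
  "sets \<mu> = sets borel \<Longrightarrow> f \<in> measurable borel N \<Longrightarrow> f \<in> measurable \<mu> N"
  using measurable_cong_sets[of \<mu> borel N N] by simp

lemma measurable_pair_if_sets_eq_borel:
  assumes "sets \<mu> = sets borel" "sets \<nu> = sets borel" "f \<in> measurable (borel \<Otimes>\<^sub>M borel) N"
  shows "f \<in> measurable (\<mu> \<Otimes>\<^sub>M \<nu>) N"
  using assms measurable_cong_sets[OF sets_pair_measure_cong[OF assms(1,2)], of N N] by simp

lemma borel_measurable_matrix_mult [measurable (raw)]:
  fixes f g :: "'a \<Rightarrow> real^'n^'n"
  assumes "f \<in> borel_measurable M" "g \<in> borel_measurable M"
  shows "(\<lambda>x. f x ** g x) \<in> borel_measurable M"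
  by (rule borel_measurable_continuous_Pair[OF assms]) (intro continuous_intros)

lemma borel_measurable_matrix_vector_mult [measurable (raw)]:
  fixes f :: "'a \<Rightarrow> real^'n^'n" and g :: "'a \<Rightarrow> real^'n"
  assumes "f \<in> borel_measurable M" "g \<in> borel_measurable M"
  shows "(\<lambda>x. f x *v g x) \<in> borel_measurable M"
  by (rule borel_measurable_continuous_Pair[OF assms]) (intro continuous_intros)

lemma borel_measurable_transpose [measurable]:
  "(transpose :: real^'n^'n \<Rightarrow> _) \<in> borel_measurable borel"
  by (intro borel_measurable_continuous_onI continuous_intros continuous_on_id)

lemma AE_of_emeasure_eq_1:
  assumes "prob_space \<mu>" "A \<in> sets \<mu>" "emeasure \<mu> A = 1"
  shows "AE x in \<mu>. x \<in> A"
proof -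
  interpret prob_space \<mu> by fact
  show ?thesis using assms(2,3) AE_in_set_eq_1[OF assms(2)] by (simp add: emeasure_eq_measure)
qed

lemma pair_prob_spaceI: "prob_space \<mu> \<Longrightarrow> prob_space \<nu> \<Longrightarrow> pair_prob_space \<mu> \<nu>"
  by (simp add: pair_prob_space.intro pair_sigma_finite_def prob_space_imp_sigma_finite)

lemma emeasure_distr_section:
  assumes "sets \<nu> = sets borel" "F \<in> borel_measurable (borel \<Otimes>\<^sub>M borel)" "X \<in> sets borel"
  shows "emeasure (distr \<nu> borel (\<lambda>b. F (a, b))) X = emeasure \<nu> {b. F (a, b) \<in> X}"
proof -
  have "(\<lambda>b. F (a, b)) \<in> borel_measurable \<nu>"
    using measurable_compose[OF measurable_Pair1' assms(2)]
    by (intro measurable_if_sets_eq_borel[OF assms(1)]) simp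
  then show ?thesis
    using assms by (simp add: emeasure_distr space_eq_UNIV_if_sets_eq_borel vimage_def)
qed

lemma emeasure_distr_pair_measure_alt:
  fixes F :: "'a::topological_space \<times> 'b::topological_space \<Rightarrow> 'c::topological_space"
  assumes \<mu>: "sets \<mu> = sets borel" "prob_space \<mu>" and \<nu>: "sets \<nu> = sets borel" "prob_space \<nu>"
    and F: "F \<in> borel_measurable (borel \<Otimes>\<^sub>M borel)" and X: "X \<in> sets borel"
  shows "emeasure (distr (\<mu> \<Otimes>\<^sub>M \<nu>) borel F) X = (\<integral>\<^sup>+a. emeasure \<nu> {b. F (a, b) \<in> X} \<partial>\<mu>)"
proof -
  interpret pair_prob_space \<mu> \<nu>
    by (rule pair_prob_spaceI[OF \<mu>(2) \<nu>(2)])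
  have F': "F \<in> borel_measurable (\<mu> \<Otimes>\<^sub>M \<nu>)"
    by (rule measurable_pair_if_sets_eq_borel[OF \<mu>(1) \<nu>(1) F])
  have space: "space (\<mu> \<Otimes>\<^sub>M \<nu>) = UNIV"
    using \<mu> \<nu> by (simp add: space_pair_measure space_eq_UNIV_if_sets_eq_borel)
  then have "F -` X \<in> sets (\<mu> \<Otimes>\<^sub>M \<nu>)"
    using measurable_sets[OF F' X] by simp
  from M2.emeasure_pair_measure_alt[OF this] show ?thesis
    using F' X space by (simp add: emeasure_distr vimage_def)
qed

lemma borel_measurable_emeasure_section:
  fixes F :: "'a::topological_space \<times> 'b::topological_space \<Rightarrow> 'c::topological_space"
  assumes \<nu>: "sets \<nu> = sets borel" "prob_space \<nu>"
    and F: "F \<in> borel_measurable (borel \<Otimes>\<^sub>M borel)" and X: "X \<in> sets borel"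
  shows "(\<lambda>a. emeasure \<nu> {b. F (a, b) \<in> X}) \<in> borel_measurable borel"
proof -
  interpret sigma_finite_measure \<nu>
    using \<nu> by (simp add: prob_space_imp_sigma_finite)
  have "measurable ((borel :: 'a measure) \<Otimes>\<^sub>M \<nu>) (borel :: 'c measure)
      = measurable (borel \<Otimes>\<^sub>M borel) borel"
    by (rule measurable_cong_sets[OF sets_pair_measure_cong[OF refl \<nu>(1)] refl])
  then have F': "F \<in> borel_measurable (borel \<Otimes>\<^sub>M \<nu>)"
    using F by simp
  have "space ((borel :: 'a measure) \<Otimes>\<^sub>M \<nu>) = UNIV"
    using \<nu> by (simp add: space_pair_measure space_eq_UNIV_if_sets_eq_borel)
  then have "F -` X \<in> sets (borel \<Otimes>\<^sub>M \<nu>)"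
    using measurable_sets[OF F' X] by simp
  from measurable_emeasure_Pair[OF this] show ?thesis
    by (simp add: vimage_def)
qed

lemma distr_pair_measure_swap:
  fixes F :: "'a::topological_space \<times> 'b::topological_space \<Rightarrow> 'c::topological_space"
  assumes \<mu>: "sets \<mu> = sets borel" "prob_space \<mu>" and \<nu>: "sets \<nu> = sets borel" "prob_space \<nu>"
    and F: "F \<in> borel_measurable (borel \<Otimes>\<^sub>M borel)"
  shows "distr (\<mu> \<Otimes>\<^sub>M \<nu>) borel F = distr (\<nu> \<Otimes>\<^sub>M \<mu>) borel (\<lambda>(b, a). F (a, b))"
proof -
  interpret pair_prob_space \<mu> \<nu>
    by (rule pair_prob_spaceI[OF \<mu>(2) \<nu>(2)])
  have "distr (\<mu> \<Otimes>\<^sub>M \<nu>) borel F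
      = distr (distr (\<nu> \<Otimes>\<^sub>M \<mu>) (\<mu> \<Otimes>\<^sub>M \<nu>) (\<lambda>(x, y). (y, x))) borel F"
    by (simp flip: distr_pair_swap)
  also have "\<dots> = distr (\<nu> \<Otimes>\<^sub>M \<mu>) borel (F \<circ> (\<lambda>(x, y). (y, x)))"
    using measurable_pair_if_sets_eq_borel[OF \<mu>(1) \<nu>(1) F]
    by (intro distr_distr) (auto intro: measurable_pair_swap')
  finally show ?thesis
    by (simp add: o_def case_prod_beta')
qed

lemma distr_pair_measure_eq_if_AE_sections:
  fixes F :: "'a::topological_space \<times> 'b::topological_space \<Rightarrow> 'c::topological_space"
  assumes \<mu>: "sets \<mu> = sets borel" "prob_space \<mu>" and \<nu>: "sets \<nu> = sets borel" "prob_space \<nu>"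
    and \<rho>: "sets \<rho> = sets borel"
    and F: "F \<in> borel_measurable (borel \<Otimes>\<^sub>M borel)"
    and sections: "AE a in \<mu>. distr \<nu> borel (\<lambda>b. F (a, b)) = \<rho>"
  shows "distr (\<mu> \<Otimes>\<^sub>M \<nu>) borel F = \<rho>"
proof (rule measure_eqI)
  fix X assume "X \<in> sets (distr (\<mu> \<Otimes>\<^sub>M \<nu>) borel F)"
  then have X: "X \<in> sets borel" by simp
  have "emeasure (distr (\<mu> \<Otimes>\<^sub>M \<nu>) borel F) X = (\<integral>\<^sup>+a. emeasure \<nu> {b. F (a, b) \<in> X} \<partial>\<mu>)"
    by (rule emeasure_distr_pair_measure_alt[OF \<mu> \<nu> F X])
  also have "\<dots> = (\<integral>\<^sup>+a. emeasure \<rho> X \<partial>\<mu>)"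
    using sections
    by (intro nn_integral_cong_AE) (auto simp flip: emeasure_distr_section[OF \<nu>(1) F X])
  also have "\<dots> = emeasure \<rho> X"
    using prob_space.emeasure_space_1[OF \<mu>(2)] by simp
  finally show "emeasure (distr (\<mu> \<Otimes>\<^sub>M \<nu>) borel F) X = emeasure \<rho> X" .
qed (simp add: \<rho>)

lemma distr_pair_measure_cong_AE:
  fixes F :: "'a::topological_space \<times> 'b::topological_space \<Rightarrow> 'c::topological_space"
    and F' :: "'a \<times> 'd::topological_space \<Rightarrow> 'c"
  assumes \<mu>: "sets \<mu> = sets borel" "prob_space \<mu>" and \<nu>: "sets \<nu> = sets borel" "prob_space \<nu>"
    and \<nu>': "sets \<nu>' = sets borel" "prob_space \<nu>'"
    and F: "F \<in> borel_measurable (borel \<Otimes>\<^sub>M borel)" and F': "F' \<in> borel_measurable (borel \<Otimes>\<^sub>M borel)"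
    and sections: "AE a in \<mu>. distr \<nu> borel (\<lambda>b. F (a, b)) = distr \<nu>' borel (\<lambda>b. F' (a, b))"
  shows "distr (\<mu> \<Otimes>\<^sub>M \<nu>) borel F = distr (\<mu> \<Otimes>\<^sub>M \<nu>') borel F'"
proof (rule measure_eqI)
  fix X assume "X \<in> sets (distr (\<mu> \<Otimes>\<^sub>M \<nu>) borel F)"
  then have X: "X \<in> sets borel" by simp
  have "emeasure (distr (\<mu> \<Otimes>\<^sub>M \<nu>) borel F) X = (\<integral>\<^sup>+a. emeasure \<nu> {b. F (a, b) \<in> X} \<partial>\<mu>)"
    by (rule emeasure_distr_pair_measure_alt[OF \<mu> \<nu> F X])
  also have "\<dots> = (\<integral>\<^sup>+a. emeasure \<nu>' {b. F' (a, b) \<in> X} \<partial>\<mu>)"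
    using sections
    by (intro nn_integral_cong_AE)
      (auto simp flip: emeasure_distr_section[OF \<nu>(1) F X] emeasure_distr_section[OF \<nu>'(1) F' X])
  also have "\<dots> = emeasure (distr (\<mu> \<Otimes>\<^sub>M \<nu>') borel F') X"
    by (rule emeasure_distr_pair_measure_alt[OF \<mu> \<nu>' F' X, symmetric])
  finally show "emeasure (distr (\<mu> \<Otimes>\<^sub>M \<nu>) borel F) X = emeasure (distr (\<mu> \<Otimes>\<^sub>M \<nu>') borel F') X" .
qed simp

lemma distr_pair_measure_fst_invariant:
  fixes F :: "'a::topological_space \<times> 'b::topological_space \<Rightarrow> 'c::topological_space"
  assumes \<mu>: "sets \<mu> = sets borel" "prob_space \<mu>" and \<nu>: "sets \<nu> = sets borel" "prob_space \<nu>"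
    and F: "F \<in> borel_measurable (borel \<Otimes>\<^sub>M borel)"
    and g: "g \<in> borel_measurable borel" "distr \<mu> borel g = \<mu>"
  shows "distr (\<mu> \<Otimes>\<^sub>M \<nu>) borel (\<lambda>(a, b). F (g a, b)) = distr (\<mu> \<Otimes>\<^sub>M \<nu>) borel F"
proof (rule measure_eqI)
  have "(\<lambda>(a, b). (g a, b)) \<in> measurable (borel \<Otimes>\<^sub>M borel) (borel \<Otimes>\<^sub>M borel)"
    using g(1) by (simp add: case_prod_beta')
  from measurable_compose[OF this F]
  have Fg: "(\<lambda>(a, b). F (g a, b)) \<in> borel_measurable (borel \<Otimes>\<^sub>M borel)"
    by (simp add: case_prod_beta')
  fix X assume "X \<in> sets (distr (\<mu> \<Otimes>\<^sub>M \<nu>) borel (\<lambda>(a, b). F (g a, b)))"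
  then have X: "X \<in> sets borel" by simp
  define \<Psi> where "\<Psi> a = emeasure \<nu> {b. F (a, b) \<in> X}" for a
  have "emeasure (distr (\<mu> \<Otimes>\<^sub>M \<nu>) borel (\<lambda>(a, b). F (g a, b))) X = (\<integral>\<^sup>+a. \<Psi> (g a) \<partial>\<mu>)"
    using emeasure_distr_pair_measure_alt[OF \<mu> \<nu> Fg X] by (simp add: \<Psi>_def)
  also have "\<dots> = (\<integral>\<^sup>+a. \<Psi> a \<partial>distr \<mu> borel g)"
    using borel_measurable_emeasure_section[OF \<nu> F X] g(1)
    by (intro nn_integral_distr[symmetric] measurable_if_sets_eq_borel[OF \<mu>(1)])
      (simp_all add: \<Psi>_def)
  also have "\<dots> = emeasure (distr (\<mu> \<Otimes>\<^sub>M \<nu>) borel F) X"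
    using emeasure_distr_pair_measure_alt[OF \<mu> \<nu> F X] by (simp add: g(2) \<Psi>_def)
  finally show "emeasure (distr (\<mu> \<Otimes>\<^sub>M \<nu>) borel (\<lambda>(a, b). F (g a, b))) X
      = emeasure (distr (\<mu> \<Otimes>\<^sub>M \<nu>) borel F) X" .
qed simp

section \<open>A rotation-invariant law on the unit sphere of a complement\<close>

definition unit_ball_measure :: "(real^'n) measure"
  where "unit_ball_measure = uniform_measure lborel (ball 0 1)"

lemma sets_unit_ball_measure [measurable_cong]: "sets unit_ball_measure = sets borel"
  by (simp add: unit_ball_measure_def)

lemma emeasure_unit_ball_measure:
  fixes B :: "(real^'n) set"
  shows "B \<in> sets borel \<Longrightarrow>
    emeasure unit_ball_measure B = emeasure lborel (ball 0 1 \<inter> B) / emeasure lborel (ball (0::real^'n) 1)"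
  unfolding unit_ball_measure_def by (subst emeasure_uniform_measure) auto

lemma prob_space_unit_ball_measure: "prob_space (unit_ball_measure :: (real^'n) measure)"
  unfolding unit_ball_measure_def
proof (rule prob_space_uniform_measure)
  have "measure lborel (ball (0::real^'n) 1) > 0"
    by (rule content_ball_pos) simp
  then show "emeasure lborel (ball (0::real^'n) 1) \<noteq> 0"
    by (auto simp: measure_def)
  show "emeasure lborel (ball (0::real^'n) 1) \<noteq> \<infinity>"
    using emeasure_lborel_ball_finite[of "0::real^'n" 1] by simp
qed

lemma distr_unit_ball_measure_orthogonal_matrix:
  fixes S :: "real^'n^'n"
  assumes S: "orthogonal_matrix S"
  shows "distr unit_ball_measure borel ((*v) S) = unit_ball_measure"
proof (rule measure_eqI)
  fix A assume "A \<in> sets (distr unit_ball_measure borel ((*v) S))"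
  then have A: "A \<in> sets borel" by simp
  have m: "(*v) S \<in> borel_measurable borel"
    by (rule linear_imp_borel_measurable) simp
  have "emeasure (distr unit_ball_measure borel ((*v) S)) A = emeasure unit_ball_measure ((*v) S -` A)"
    using A m by (simp add: emeasure_distr measurable_if_sets_eq_borel sets_unit_ball_measure
        space_eq_UNIV_if_sets_eq_borel)
  also have "\<dots> = emeasure lborel (ball 0 1 \<inter> (*v) S -` A) / emeasure lborel (ball (0::real^'n) 1)"
    using measurable_sets[OF m A] by (simp add: emeasure_unit_ball_measure)
  also have "ball 0 1 \<inter> (*v) S -` A = (*v) S -` (ball 0 1 \<inter> A)"
    using norm_orthogonal_matrix[OF S] by auto
  also have "emeasure lborel ((*v) S -` (ball 0 1 \<inter> A))
      = emeasure (distr lborel borel ((*v) S)) (ball 0 1 \<inter> A)"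
    using m A by (subst emeasure_distr) auto
  also have "\<dots> / emeasure lborel (ball (0::real^'n) 1) = emeasure unit_ball_measure A"
    using A by (simp add: distr_lborel_orthogonal_matrix[OF S] emeasure_unit_ball_measure)
  finally show "emeasure (distr unit_ball_measure borel ((*v) S)) A = emeasure unit_ball_measure A" .
qed (simp add: sets_unit_ball_measure)

lemma emeasure_unit_ball_measure_subspace:
  fixes W :: "(real^'n) set"
  assumes W: "subspace W" "dim W < CARD('n)"
  shows "emeasure unit_ball_measure W = 0"
proof -
  have W_borel: "W \<in> sets borel"
    using closed_subspace[OF W(1)] by (simp add: borel_closed)
  have "negligible W"
    by (rule negligible_lowdim) (use W in simp)
  then have "W \<in> null_sets lborel"
    using null_sets_completion_iff[of W lborel] W_borel by (simp add: negligible_iff_null_sets)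
  then have "emeasure lborel (ball 0 1 \<inter> W) = 0"
    by (meson emeasure_eq_0 inf_le2 null_setsD1 null_setsD2)
  then show ?thesis
    using W_borel by (simp add: emeasure_unit_ball_measure)
qed

definition residual_direction :: "(real^'n) set \<Rightarrow> (real^'n) measure"
  where "residual_direction V = distr unit_ball_measure borel (\<lambda>g. sgn (g - orth_proj V g))"

lemma borel_measurable_residual_sgn:
  fixes V :: "(real^'n) set"
  assumes V: "subspace V"
  shows "(\<lambda>g. sgn (g - orth_proj V g)) \<in> borel_measurable borel"
proof -
  have "orth_proj V \<in> borel_measurable borel"
    by (rule linear_imp_borel_measurable[OF linear_orth_proj[OF V]])
  then have "(\<lambda>g. g - orth_proj V g) \<in> borel_measurable borel"
    by measurable
  then show ?thesis
    by measurable
qed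

lemma sets_residual_direction: "sets (residual_direction V) = sets borel"
  by (simp add: residual_direction_def)

lemma prob_space_residual_direction:
  fixes V :: "(real^'n) set"
  assumes V: "subspace V"
  shows "prob_space (residual_direction V)"
  unfolding residual_direction_def
  by (rule prob_space.prob_space_distr[OF prob_space_unit_ball_measure
        measurable_if_sets_eq_borel[OF sets_unit_ball_measure borel_measurable_residual_sgn[OF V]]])

lemma emeasure_residual_direction_sphere:
  fixes V :: "(real^'n) set"
  assumes V: "subspace V" "dim V < CARD('n)"
  shows "emeasure (residual_direction V) (orthogonal_comp V \<inter> sphere 0 1) = 1"
proof -
  let ?r = "\<lambda>g. sgn (g - orth_proj V g)" and ?C = "orthogonal_comp V \<inter> sphere 0 1"
  interpret prob_space "unit_ball_measure :: (real^'n) measure"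
    by (rule prob_space_unit_ball_measure)
  have r_meas: "?r \<in> borel_measurable unit_ball_measure"
    by (intro measurable_if_sets_eq_borel[OF sets_unit_ball_measure] borel_measurable_residual_sgn V)
  have C: "?C \<in> sets borel"
    using closed_subspace[OF subspace_orthogonal_comp] by (intro sets.Int borel_closed) auto
  have "?r g \<in> ?C" if "g \<notin> V" for g
  proof -
    have "g - orth_proj V g \<noteq> 0"
      using that orth_proj_in_subspace[OF V(1), of g] by (metis eq_iff_diff_eq_0)
    moreover have "?r g \<in> orthogonal_comp V"
      unfolding sgn_div_norm using orth_proj_residual_orthogonal[OF V(1)]
      by (intro subspace_scale[OF subspace_orthogonal_comp])
    ultimately show ?thesis by (simp add: norm_sgn)
  qed
  moreover have "AE g in unit_ball_measure. g \<notin> V"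
    using emeasure_unit_ball_measure_subspace[OF V] closed_subspace[OF V(1)]
    by (intro AE_I[where N = V]) (auto simp: borel_closed sets_unit_ball_measure)
  ultimately have "AE g in unit_ball_measure. ?r g \<in> ?C"
    by (auto elim: AE_mp)
  moreover have pre: "?r -` ?C \<in> sets unit_ball_measure"
    using measurable_sets[OF r_meas C] by (simp add: space_eq_UNIV_if_sets_eq_borel[OF sets_unit_ball_measure])
  ultimately have "emeasure unit_ball_measure (?r -` ?C) = 1"
    by (intro emeasure_eq_1_AE) auto
  then show ?thesis
    unfolding residual_direction_def using r_meas C
    by (simp add: emeasure_distr space_eq_UNIV_if_sets_eq_borel[OF sets_unit_ball_measure])
qed

lemma distr_residual_direction_orth_fix:
  fixes V :: "(real^'n) set"
  assumes V: "subspace V" and S: "S \<in> orth_fix V"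
  shows "distr (residual_direction V) borel ((*v) S) = residual_direction V"
proof -
  let ?r = "\<lambda>g. sgn (g - orth_proj V g)"
  have m: "(*v) S \<in> borel_measurable borel"
    by (rule linear_imp_borel_measurable) simp
  have r_meas: "?r \<in> borel_measurable unit_ball_measure"
    by (intro measurable_if_sets_eq_borel[OF sets_unit_ball_measure] borel_measurable_residual_sgn V)
  have "S *v ?r g = ?r (S *v g)" for g
  proof -
    have "S *v (g - orth_proj V g) = S *v g - orth_proj V (S *v g)"
      using orth_fix_fixes[OF S orth_proj_in_subspace[OF V]] orth_proj_orth_fix[OF V S]
      by (simp add: matrix_vector_mult_diff_distrib)
    then show ?thesis
      by (simp add: sgn_orthogonal_matrix[OF orth_fix_orthogonal_matrix[OF S]])
  qed
  then have "(*v) S \<circ> ?r = ?r \<circ> (*v) S"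
    by auto
  moreover have "(*v) S \<in> borel_measurable unit_ball_measure"
    by (rule measurable_if_sets_eq_borel[OF sets_unit_ball_measure m])
  ultimately have "distr (residual_direction V) borel ((*v) S)
      = distr (distr unit_ball_measure borel ((*v) S)) borel ?r"
    unfolding residual_direction_def using r_meas m borel_measurable_residual_sgn[OF V]
    by (simp add: distr_distr)
  also have "\<dots> = residual_direction V"
    by (simp add: distr_unit_ball_measure_orthogonal_matrix[OF orth_fix_orthogonal_matrix[OF S]]
        residual_direction_def)
  finally show ?thesis .
qed

section \<open>Haar measure on O_n(V)\<close>

definition is_Haar_fix :: "(real^'n) set \<Rightarrow> (real^'n^'n) measure \<Rightarrow> bool" where
  "is_Haar_fix V \<mu> \<longleftrightarrow> sets \<mu> = sets borel \<and> prob_space \<mu> \<and> emeasure \<mu> (orth_fix V) = 1 \<and>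
     (\<forall>S\<in>orth_fix V. distr \<mu> borel (\<lambda>T. S ** T) = \<mu>)"

lemma Haar_fix_eq_The: "Haar_fix V = The (is_Haar_fix V)"
  unfolding Haar_fix_def is_Haar_fix_def by (rule arg_cong[where f = The]) (simp add: fun_eq_iff)

lemma is_Haar_fixD:
  assumes "is_Haar_fix V \<mu>"
  shows "sets \<mu> = sets borel" "prob_space \<mu>" "AE T in \<mu>. T \<in> orth_fix V"
    and "S \<in> orth_fix V \<Longrightarrow> distr \<mu> borel (\<lambda>T. S ** T) = \<mu>"
  using assms by (auto simp: is_Haar_fix_def intro: AE_of_emeasure_eq_1)

lemma is_Haar_fix_UNIV: "is_Haar_fix UNIV (return borel (mat 1 :: real^'n^'n))"
proof -
  have "(\<lambda>T. S ** T) \<in> borel_measurable (borel :: (real^'n^'n) measure)" for S :: "real^'n^'n"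
    by measurable
  then show ?thesis
    unfolding is_Haar_fix_def orth_fix_UNIV
    by (auto simp: prob_space_return distr_return matrix_mul_lid)
qed

lemma householder_conjugate_orth_fix:
  assumes e: "e \<in> orthogonal_comp V" "norm e = 1" and u: "u \<in> orthogonal_comp V" "norm u = 1"
    and S: "S \<in> orth_fix V"
  shows "householder e (S *v u) ** S ** householder e u \<in> orth_fix (span (insert e V))"
proof -
  define R where "R = householder e (S *v u) ** S ** householder e u"
  have Su: "S *v u \<in> orthogonal_comp V" "norm (S *v u) = 1"
    using orth_fix_orthogonal_comp[OF S u(1)] norm_orthogonal_matrix[OF orth_fix_orthogonal_matrix[OF S]] u
    by auto
  have R_apply: "R *v v = householder e (S *v u) *v (S *v (householder e u *v v))" for v
    by (simp add: R_def matrix_vector_mul_assoc matrix_mul_assoc)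
  have "R *v v = v" if "v \<in> insert e V" for v
  proof (cases "v = e")
    case True
    then show ?thesis
      using e(2) u(2) Su(2) by (simp add: R_apply householder_maps householder_maps_back)
  next
    case False
    then have "v \<in> V" using that by simp
    then show ?thesis
      using householder_orth_fix[OF e(1) u(1)] householder_orth_fix[OF e(1) Su(1)] S
      by (simp add: R_apply orth_fix_fixes)
  qed
  then have "span (insert e V) \<subseteq> {v. R *v v = v}"
    by (intro span_minimal) (auto simp: subspace_def matrix_vector_right_distrib
        matrix_vector_mult_scaleR)
  moreover have "orthogonal_matrix R"
    unfolding R_def
    by (intro orthogonal_matrix_mul orthogonal_matrix_householder orth_fix_orthogonal_matrix[OF S])
  ultimately show ?thesis
    by (auto simp: orth_fix_def R_def)
qed

lemma borel_measurable_householder_mult: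
  "(\<lambda>(u, T :: real^'n^'n). householder e u ** T) \<in> borel_measurable (borel \<Otimes>\<^sub>M borel)"
  unfolding case_prod_beta'
  by (intro borel_measurable_matrix_mult borel_measurable_householder measurable_fst measurable_snd)

lemma distr_Haar_fix_mult_householder:
  fixes V :: "(real^'n) set"
  assumes e: "e \<in> orthogonal_comp V" "norm e = 1" and u: "u \<in> orthogonal_comp V" "norm u = 1"
    and S: "S \<in> orth_fix V" and \<mu>': "is_Haar_fix (span (insert e V)) \<mu>'"
  shows "distr \<mu>' borel (\<lambda>T. S ** (householder e u ** T))
    = distr \<mu>' borel (\<lambda>T. householder e (S *v u) ** T)"
proof -
  define R where "R = householder e (S *v u) ** S ** householder e u"
  have R: "R \<in> orth_fix (span (insert e V))"
    unfolding R_def by (rule householder_conjugate_orth_fix[OF e u S])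
  have "S ** (householder e u ** T) = householder e (S *v u) ** (R ** T)" for T :: "real^'n^'n"
    by (simp add: R_def matrix_mul_assoc householder_involutive flip: matrix_mul_assoc[of _ _ S])
  moreover have "(\<lambda>T. R ** T) \<in> borel_measurable \<mu>'"
    by (intro measurable_if_sets_eq_borel[OF is_Haar_fixD(1)[OF \<mu>']]) measurable
  ultimately have "distr \<mu>' borel (\<lambda>T. S ** (householder e u ** T))
      = distr (distr \<mu>' borel (\<lambda>T. R ** T)) borel (\<lambda>T. householder e (S *v u) ** T)"
    by (simp add: distr_distr comp_def)
  then show ?thesis
    by (simp add: is_Haar_fixD(4)[OF \<mu>' R])
qed

lemma emeasure_householder_mixture_orth_fix:
  fixes V :: "(real^'n) set"
  assumes e: "e \<in> orthogonal_comp V"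
    and \<sigma>: "sets \<sigma> = sets borel" "prob_space \<sigma>" "AE u in \<sigma>. u \<in> orthogonal_comp V"
    and \<mu>': "is_Haar_fix (span (insert e V)) \<mu>'"
  shows "emeasure (distr (\<sigma> \<Otimes>\<^sub>M \<mu>') borel (\<lambda>(u, T). householder e u ** T)) (orth_fix V) = 1"
proof -
  let ?G = "orth_fix V" and ?F = "\<lambda>(u, T :: real^'n^'n). householder e u ** T"
  note \<mu>'D = is_Haar_fixD[OF \<mu>']
  interpret pair_prob_space \<sigma> \<mu>'
    by (rule pair_prob_spaceI[OF \<sigma>(2) \<mu>'D(2)])
  have F: "?F \<in> borel_measurable (\<sigma> \<Otimes>\<^sub>M \<mu>')"
    by (rule measurable_pair_if_sets_eq_borel[OF \<sigma>(1) \<mu>'D(1) borel_measurable_householder_mult])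
  have sub: "orth_fix (span (insert e V)) \<subseteq> ?G"
    by (rule orth_fix_antimono) (meson span_superset subset_insertI subset_trans)
  have "AE u in \<sigma>. AE T in \<mu>'. ?F (u, T) \<in> ?G"
    using \<sigma>(3)
  proof eventually_elim
    case (elim u)
    then have "householder e u \<in> ?G"
      by (simp add: householder_orth_fix[OF e])
    from \<mu>'D(3) show ?case
      by eventually_elim (simp add: orth_fix_mult[OF \<open>householder e u \<in> ?G\<close>] subsetD[OF sub])
  qed
  moreover have "{p \<in> space (\<sigma> \<Otimes>\<^sub>M \<mu>'). ?F p \<in> ?G} \<in> sets (\<sigma> \<Otimes>\<^sub>M \<mu>')"
    using measurable_sets[OF F orth_fix_borel] unfolding vimage_def Int_def by (simp add: conj_commute)
  ultimately have "AE p in \<sigma> \<Otimes>\<^sub>M \<mu>'. ?F p \<in> ?G"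
    by (intro AE_pair_measure) simp_all
  then have "emeasure (\<sigma> \<Otimes>\<^sub>M \<mu>') (?F -` ?G \<inter> space (\<sigma> \<Otimes>\<^sub>M \<mu>')) = 1"
    using measurable_sets[OF F orth_fix_borel] by (intro emeasure_eq_1_AE) auto
  then show ?thesis
    using F by (simp add: emeasure_distr)
qed

lemma is_Haar_fix_householder_mixture:
  fixes V :: "(real^'n) set"
  assumes e: "e \<in> orthogonal_comp V" "norm e = 1"
    and \<sigma>: "sets \<sigma> = sets borel" "prob_space \<sigma>" "emeasure \<sigma> (orthogonal_comp V \<inter> sphere 0 1) = 1"
      "\<And>S. S \<in> orth_fix V \<Longrightarrow> distr \<sigma> borel ((*v) S) = \<sigma>"
    and \<mu>': "is_Haar_fix (span (insert e V)) \<mu>'"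
  shows "is_Haar_fix V (distr (\<sigma> \<Otimes>\<^sub>M \<mu>') borel (\<lambda>(u, T). householder e u ** T))"
proof -
  let ?F = "\<lambda>(u, T :: real^'n^'n). householder e u ** T"
  note \<mu>'D = is_Haar_fixD[OF \<mu>'] and F = borel_measurable_householder_mult[of e]
  have "orthogonal_comp V \<inter> sphere 0 1 \<in> sets borel"
    using closed_subspace[OF subspace_orthogonal_comp] by (intro sets.Int borel_closed) auto
  then have AE_C: "AE u in \<sigma>. u \<in> orthogonal_comp V \<inter> sphere 0 1"
    using \<sigma>(1-3) by (intro AE_of_emeasure_eq_1) auto
  have "distr (distr (\<sigma> \<Otimes>\<^sub>M \<mu>') borel ?F) borel (\<lambda>T. S ** T) = distr (\<sigma> \<Otimes>\<^sub>M \<mu>') borel ?F"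
    if S: "S \<in> orth_fix V" for S
  proof -
    have "AE u in \<sigma>. distr \<mu>' borel (\<lambda>T. S ** (householder e u ** T))
        = distr \<mu>' borel (\<lambda>T. householder e (S *v u) ** T)"
      using AE_C by eventually_elim (auto intro: distr_Haar_fix_mult_householder[OF e _ _ S \<mu>'])
    then have "distr (\<sigma> \<Otimes>\<^sub>M \<mu>') borel (\<lambda>(u, T). S ** (householder e u ** T))
        = distr (\<sigma> \<Otimes>\<^sub>M \<mu>') borel (\<lambda>(u, T). householder e (S *v u) ** T)"
      by (intro distr_pair_measure_cong_AE \<sigma>(1,2) \<mu>'D(1,2)) (simp_all, measurable)
    also have "\<dots> = distr (\<sigma> \<Otimes>\<^sub>M \<mu>') borel ?F"
      using distr_pair_measure_fst_invariant[OF \<sigma>(1,2) \<mu>'D(1,2) F, of "(*v) S"] \<sigma>(4)[OF S]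
      by (simp add: linear_imp_borel_measurable)
    finally show ?thesis
      using measurable_pair_if_sets_eq_borel[OF \<sigma>(1) \<mu>'D(1) F]
      by (subst distr_distr) (auto simp: comp_def case_prod_beta')
  qed
  moreover have "emeasure (distr (\<sigma> \<Otimes>\<^sub>M \<mu>') borel ?F) (orth_fix V) = 1"
    using AE_C by (intro emeasure_householder_mixture_orth_fix[OF e(1) \<sigma>(1,2) _ \<mu>']) auto
  moreover have "prob_space (distr (\<sigma> \<Otimes>\<^sub>M \<mu>') borel ?F)"
    using measurable_pair_if_sets_eq_borel[OF \<sigma>(1) \<mu>'D(1) F]
    by (rule prob_space.prob_space_distr[OF prob_space_pair[OF \<sigma>(2) \<mu>'D(2)]])
  ultimately show ?thesis
    unfolding is_Haar_fix_def by simp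
qed

lemma subspace_ne_UNIV_iff_dim_less:
  fixes V :: "(real^'n) set"
  assumes "subspace V"
  shows "V \<noteq> UNIV \<longleftrightarrow> dim V < CARD('n)"
  using dim_subset_UNIV_cart[of V] subspace_dim_equal[OF assms subspace_UNIV]
  by (cases "V = UNIV") auto

lemma is_Haar_fix_exists:
  fixes V :: "(real^'n) set"
  assumes "subspace V"
  shows "\<exists>\<mu>. is_Haar_fix V \<mu>"
  using assms
proof (induction "CARD('n) - dim V" arbitrary: V rule: less_induct)
  case less
  show ?case
  proof (cases "V = UNIV")
    case True
    then show ?thesis using is_Haar_fix_UNIV by blast
  next
    case False
    then have dim_V: "dim V < CARD('n)"
      using subspace_ne_UNIV_iff_dim_less[OF less.prems] by blast
    obtain e where e: "e \<in> orthogonal_comp V" "norm e = 1"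
      using unit_vector_in_orthogonal_comp[OF less.prems False] .
    have "e \<notin> V"
    proof
      assume "e \<in> V"
      then have "e = 0" using e(1) orthogonal_Int_0[OF less.prems] by blast
      then show False using e(2) by simp
    qed
    then have "dim (span (insert e V)) = dim V + 1"
      using span_eq_iff[of V] less.prems by (simp add: dim_insert del: span_eq_iff)
    then have "CARD('n) - dim (span (insert e V)) < CARD('n) - dim V"
      using dim_V by simp
    then obtain \<mu>' where "is_Haar_fix (span (insert e V)) \<mu>'"
      using less.hyps subspace_span by blast
    from is_Haar_fix_householder_mixture[OF e sets_residual_direction
        prob_space_residual_direction[OF less.prems]
        emeasure_residual_direction_sphere[OF less.prems dim_V]
        distr_residual_direction_orth_fix[OF less.prems] this]
    show ?thesis by blast
  qed
qed

lemma is_Haar_fix_distr_transpose_right_invariant: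
  fixes V :: "(real^'n) set"
  assumes \<mu>: "is_Haar_fix V \<mu>" and S: "S \<in> orth_fix V"
  shows "distr (distr \<mu> borel transpose) borel (\<lambda>T. T ** S) = distr \<mu> borel transpose"
proof -
  note \<mu>D = is_Haar_fixD[OF \<mu>]
  have t: "transpose \<in> borel_measurable \<mu>" "transpose \<in> borel_measurable (borel :: (real^'n^'n) measure)"
    by (intro measurable_if_sets_eq_borel[OF \<mu>D(1)] borel_measurable_transpose)+
  have "(\<lambda>T :: real^'n^'n. T ** S) \<in> borel_measurable borel"
    by measurable
  then have "distr (distr \<mu> borel transpose) borel (\<lambda>T. T ** S) = distr \<mu> borel ((\<lambda>T. T ** S) \<circ> transpose)"
    by (rule distr_distr[OF _ t(1)])
  also have "(\<lambda>T. T ** S) \<circ> transpose = transpose \<circ> (\<lambda>T. transpose S ** T)"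
    by (auto simp: fun_eq_iff matrix_transpose_mul)
  also have "distr \<mu> borel \<dots> = distr (distr \<mu> borel (\<lambda>T. transpose S ** T)) borel transpose"
    by (rule distr_distr[symmetric, OF t(2)]) (intro measurable_if_sets_eq_borel[OF \<mu>D(1)]; measurable)
  also have "\<dots> = distr \<mu> borel transpose"
    by (simp add: \<mu>D(4)[OF orth_fix_transpose[OF S]])
  finally show ?thesis .
qed

text \<open>Uniqueness: with \<open>\<mu>\<^sup>t\<close> the image of \<open>\<mu>\<close> under transposition, the law of \<open>S ** T\<close> for
  independent \<open>S \<sim> \<mu>\<^sup>t\<close> and \<open>T \<sim> \<nu>\<close> equals \<open>\<nu>\<close> by left invariance of \<open>\<nu>\<close> and \<open>\<mu>\<^sup>t\<close> by right
  invariance of \<open>\<mu>\<^sup>t\<close>.\<close>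

lemma is_Haar_fix_eq_distr_transpose:
  fixes V :: "(real^'n) set"
  assumes \<mu>: "is_Haar_fix V \<mu>" and \<nu>: "is_Haar_fix V \<nu>"
  shows "\<nu> = distr \<mu> borel transpose"
proof -
  let ?G = "orth_fix V" and ?\<mu>t = "distr \<mu> borel transpose"
  note \<mu>D = is_Haar_fixD[OF \<mu>] and \<nu>D = is_Haar_fixD[OF \<nu>]
  have t_meas: "transpose \<in> borel_measurable \<mu>"
    by (intro measurable_if_sets_eq_borel[OF \<mu>D(1)] borel_measurable_transpose)
  have \<mu>t: "sets ?\<mu>t = sets borel" "prob_space ?\<mu>t"
    using prob_space.prob_space_distr[OF \<mu>D(2) t_meas] by simp_all
  have "AE T in \<mu>. transpose T \<in> ?G"
    using \<mu>D(3) by eventually_elim (rule orth_fix_transpose)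
  then have AE_t: "AE S in ?\<mu>t. S \<in> ?G"
    by (subst AE_distr_iff[OF t_meas]) simp_all
  have mult: "(\<lambda>(S :: real^'n^'n, T :: real^'n^'n). S ** T) \<in> borel_measurable (borel \<Otimes>\<^sub>M borel)"
    and mult': "(\<lambda>(T :: real^'n^'n, S :: real^'n^'n). S ** T) \<in> borel_measurable (borel \<Otimes>\<^sub>M borel)"
    unfolding case_prod_beta' by (intro borel_measurable_matrix_mult measurable_fst measurable_snd)+
  have left: "AE S in ?\<mu>t. distr \<nu> borel (\<lambda>T. S ** T) = \<nu>"
    using AE_t by eventually_elim (simp add: \<nu>D(4))
  have right: "AE T in \<nu>. distr ?\<mu>t borel (\<lambda>S. S ** T) = ?\<mu>t"
    using \<nu>D(3) by eventually_elim (simp add: is_Haar_fix_distr_transpose_right_invariant[OF \<mu>])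
  have "distr (?\<mu>t \<Otimes>\<^sub>M \<nu>) borel (\<lambda>(S, T). S ** T) = \<nu>"
    by (rule distr_pair_measure_eq_if_AE_sections[OF \<mu>t \<nu>D(1,2) \<nu>D(1) mult]) (use left in simp)
  moreover have "distr (?\<mu>t \<Otimes>\<^sub>M \<nu>) borel (\<lambda>(S, T). S ** T)
      = distr (\<nu> \<Otimes>\<^sub>M ?\<mu>t) borel (\<lambda>(T, S). S ** T)"
    using distr_pair_measure_swap[OF \<mu>t \<nu>D(1,2) mult] by simp
  moreover have "\<dots> = ?\<mu>t"
    by (rule distr_pair_measure_eq_if_AE_sections[OF \<nu>D(1,2) \<mu>t \<mu>t(1) mult']) (use right in simp)
  ultimately show ?thesis
    by simp
qed

lemma is_Haar_fix_unique:
  fixes V :: "(real^'n) set"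
  assumes "is_Haar_fix V \<mu>" "is_Haar_fix V \<nu>"
  shows "\<nu> = \<mu>"
  using is_Haar_fix_eq_distr_transpose[OF assms] is_Haar_fix_eq_distr_transpose[OF assms(1,1)]
  by simp

lemma is_Haar_fix_Haar_fix:
  fixes V :: "(real^'n) set"
  assumes "subspace V"
  shows "is_Haar_fix V (Haar_fix V)"
  using is_Haar_fix_exists[OF assms] is_Haar_fix_unique
  unfolding Haar_fix_eq_The by (metis theI)

lemma is_Haar_fix_right_invariant:
  fixes V :: "(real^'n) set"
  assumes "is_Haar_fix V \<mu>" "S \<in> orth_fix V"
  shows "distr \<mu> borel (\<lambda>T. T ** S) = \<mu>"
  using is_Haar_fix_distr_transpose_right_invariant[OF assms]
    is_Haar_fix_eq_distr_transpose[OF assms(1,1)]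
  by simp

section \<open>Orbits of the Haar measure and the uniform distribution on the sphere\<close>

lemma distr_Haar_fix_apply_unit_vector:
  fixes V :: "(real^'n) set"
  assumes \<eta>: "is_Haar_fix V \<eta>" and e: "e \<in> orthogonal_comp V" "norm e = 1"
    and x: "x \<in> orthogonal_comp V" "norm x = 1"
  shows "distr \<eta> borel (\<lambda>T. T *v x) = distr \<eta> borel (\<lambda>T. T *v e)"
proof -
  define R where "R = householder e x"
  have R: "R \<in> orth_fix V" "R *v e = x"
    unfolding R_def using e x by (simp_all add: householder_orth_fix householder_maps)
  have "(\<lambda>T :: real^'n^'n. T ** R) \<in> borel_measurable \<eta>"
    by (intro measurable_if_sets_eq_borel[OF is_Haar_fixD(1)[OF \<eta>]]) measurable
  then have "distr \<eta> borel (\<lambda>T. T *v x) = distr (distr \<eta> borel (\<lambda>T. T ** R)) borel (\<lambda>T. T *v e)"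
    using R(2) by (simp add: distr_distr comp_def matrix_vector_mul_assoc[symmetric])
  then show ?thesis
    by (simp add: is_Haar_fix_right_invariant[OF \<eta> R(1)])
qed

lemma distr_Haar_fix_orbit:
  fixes V :: "(real^'n) set"
  assumes V: "subspace V" and \<eta>: "is_Haar_fix V \<eta>" and e: "e \<in> orthogonal_comp V" "norm e = 1"
  shows "distr \<eta> borel (\<lambda>T. T *v v)
    = distr (distr \<eta> borel (\<lambda>T. T *v e)) borel (\<lambda>u. orth_proj V v + norm (v - orth_proj V v) *\<^sub>R u)"
proof -
  define P r where "P = orth_proj V v" and "r = norm (v - P)"
  \<comment> \<open>any unit vector of the complement works when v lies in V\<close>
  define e' where "e' = (if r = 0 then e else (1 / r) *\<^sub>R (v - P))"
  have e': "e' \<in> orthogonal_comp V" "norm e' = 1"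
    using e orth_proj_residual_orthogonal[OF V, of v]
    by (auto simp: e'_def r_def P_def intro: subspace_scale[OF subspace_orthogonal_comp])
  have v: "v = P + r *\<^sub>R e'"
    by (auto simp: e'_def r_def)
  have "AE T in \<eta>. T *v v = P + r *\<^sub>R (T *v e')"
    using is_Haar_fixD(3)[OF \<eta>]
  proof eventually_elim
    case (elim T)
    then have "T *v P = P"
      by (simp add: P_def orth_fix_fixes[OF elim orth_proj_in_subspace[OF V]])
    then show ?case
      by (subst v) (simp add: matrix_vector_right_distrib matrix_vector_mult_scaleR)
  qed
  then have "distr \<eta> borel (\<lambda>T. T *v v) = distr \<eta> borel (\<lambda>T. P + r *\<^sub>R (T *v e'))"
    using is_Haar_fixD(1)[OF \<eta>]
    by (intro distr_cong_AE) (auto intro!: measurable_if_sets_eq_borel)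
  also have "\<dots> = distr (distr \<eta> borel (\<lambda>T. T *v e')) borel (\<lambda>u. P + r *\<^sub>R u)"
    using is_Haar_fixD(1)[OF \<eta>]
    by (subst distr_distr) (auto intro!: measurable_if_sets_eq_borel simp: comp_def)
  finally show ?thesis
    by (simp add: distr_Haar_fix_apply_unit_vector[OF \<eta> e e'] P_def r_def)
qed

definition is_unif_sphere :: "(real^'n) set \<Rightarrow> (real^'n) measure \<Rightarrow> bool" where
  "is_unif_sphere W \<mu> \<longleftrightarrow> sets \<mu> = sets borel \<and> prob_space \<mu> \<and> emeasure \<mu> (W \<inter> sphere 0 1) = 1 \<and>
     (\<forall>S\<in>orth_fix (orthogonal_comp W). distr \<mu> borel (\<lambda>u. S *v u) = \<mu>)"

lemma unif_sphere_eq_The: "unif_sphere W = The (is_unif_sphere W)"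
  unfolding unif_sphere_def is_unif_sphere_def by (rule arg_cong[where f = The]) (simp add: fun_eq_iff)

lemma is_unif_sphere_distr_Haar_fix:
  fixes V :: "(real^'n) set"
  assumes V: "subspace V" and \<eta>: "is_Haar_fix V \<eta>" and e: "e \<in> orthogonal_comp V" "norm e = 1"
  shows "is_unif_sphere (orthogonal_comp V) (distr \<eta> borel (\<lambda>T. T *v e))"
proof -
  let ?C = "orthogonal_comp V \<inter> sphere 0 1"
  note \<eta>D = is_Haar_fixD[OF \<eta>]
  have apply_e: "(\<lambda>T. T *v e) \<in> borel_measurable \<eta>"
    by (intro measurable_if_sets_eq_borel[OF \<eta>D(1)]) measurable
  have C: "?C \<in> sets borel"
    using closed_subspace[OF subspace_orthogonal_comp] by (intro sets.Int borel_closed) auto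
  have "AE T in \<eta>. T *v e \<in> ?C"
    using \<eta>D(3) by eventually_elim
      (simp add: orth_fix_orthogonal_comp[OF _ e(1)] norm_orthogonal_matrix orth_fix_orthogonal_matrix e(2))
  moreover have "{u \<in> space borel. u \<in> ?C} \<in> sets borel"
    using C by (simp only: space_borel UNIV_I simp_thms Collect_mem_eq)
  ultimately have "AE u in distr \<eta> borel (\<lambda>T. T *v e). u \<in> ?C"
    by (simp only: AE_distr_iff[OF apply_e])
  then have "emeasure (distr \<eta> borel (\<lambda>T. T *v e)) ?C = 1"
    using C by (intro prob_space.emeasure_eq_1_AE prob_space.prob_space_distr[OF \<eta>D(2) apply_e]) simp_all
  moreover have "distr (distr \<eta> borel (\<lambda>T. T *v e)) borel (\<lambda>u. S *v u) = distr \<eta> borel (\<lambda>T. T *v e)"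
    if S: "S \<in> orth_fix V" for S
  proof -
    have "(\<lambda>T :: real^'n^'n. S ** T) \<in> borel_measurable \<eta>"
      by (intro measurable_if_sets_eq_borel[OF \<eta>D(1)]) measurable
    then have "distr (distr \<eta> borel (\<lambda>T. T *v e)) borel (\<lambda>u. S *v u)
        = distr (distr \<eta> borel (\<lambda>T. S ** T)) borel (\<lambda>T. T *v e)"
      using apply_e by (simp add: distr_distr comp_def matrix_vector_mul_assoc)
    then show ?thesis
      by (simp add: \<eta>D(4)[OF S])
  qed
  ultimately show ?thesis
    unfolding is_unif_sphere_def orthogonal_comp_self[OF V]
    using prob_space.prob_space_distr[OF \<eta>D(2) apply_e] by simp
qed

lemma is_unif_sphere_unique:
  fixes V :: "(real^'n) set"
  assumes V: "subspace V" and \<eta>: "is_Haar_fix V \<eta>" and e: "e \<in> orthogonal_comp V" "norm e = 1"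
    and \<mu>: "is_unif_sphere (orthogonal_comp V) \<mu>"
  shows "\<mu> = distr \<eta> borel (\<lambda>T. T *v e)"
proof -
  let ?C = "orthogonal_comp V \<inter> sphere 0 1"
  note \<eta>D = is_Haar_fixD[OF \<eta>]
  have \<mu>D: "sets \<mu> = sets borel" "prob_space \<mu>" "emeasure \<mu> ?C = 1"
    "\<And>S. S \<in> orth_fix V \<Longrightarrow> distr \<mu> borel (\<lambda>u. S *v u) = \<mu>"
    using \<mu> unfolding is_unif_sphere_def orthogonal_comp_self[OF V] by auto
  have C: "?C \<in> sets borel"
    using closed_subspace[OF subspace_orthogonal_comp] by (intro sets.Int borel_closed) auto
  have apply_mv: "(\<lambda>(T :: real^'n^'n, x). T *v x) \<in> borel_measurable (borel \<Otimes>\<^sub>M borel)"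
    and apply_vm: "(\<lambda>(x, T :: real^'n^'n). T *v x) \<in> borel_measurable (borel \<Otimes>\<^sub>M borel)"
    unfolding case_prod_beta' by (intro borel_measurable_matrix_vector_mult measurable_fst measurable_snd)+
  have "AE T in \<eta>. distr \<mu> borel (\<lambda>x. T *v x) = \<mu>"
    using \<eta>D(3) by eventually_elim (rule \<mu>D(4))
  then have "distr (\<eta> \<Otimes>\<^sub>M \<mu>) borel (\<lambda>(T, x). T *v x) = \<mu>"
    by (intro distr_pair_measure_eq_if_AE_sections[OF \<eta>D(1,2) \<mu>D(1,2) \<mu>D(1) apply_mv]) simp
  moreover have "distr (\<eta> \<Otimes>\<^sub>M \<mu>) borel (\<lambda>(T, x). T *v x) = distr (\<mu> \<Otimes>\<^sub>M \<eta>) borel (\<lambda>(x, T). T *v x)"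
    using distr_pair_measure_swap[OF \<eta>D(1,2) \<mu>D(1,2) apply_mv] by simp
  moreover have "AE x in \<mu>. x \<in> ?C"
    by (rule AE_of_emeasure_eq_1[OF \<mu>D(2) _ \<mu>D(3)]) (use C \<mu>D(1) in simp)
  then have "AE x in \<mu>. distr \<eta> borel (\<lambda>T. T *v x) = distr \<eta> borel (\<lambda>T. T *v e)"
    by eventually_elim (auto intro: distr_Haar_fix_apply_unit_vector[OF \<eta> e])
  then have "distr (\<mu> \<Otimes>\<^sub>M \<eta>) borel (\<lambda>(x, T). T *v x) = distr \<eta> borel (\<lambda>T. T *v e)"
    by (intro distr_pair_measure_eq_if_AE_sections[OF \<mu>D(1,2) \<eta>D(1,2) _ apply_vm]) simp_all
  ultimately show ?thesis
    by simp
qed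

lemma unif_sphere_eq_distr_Haar_fix:
  fixes V :: "(real^'n) set"
  assumes V: "subspace V" and e: "e \<in> orthogonal_comp V" "norm e = 1"
  shows "unif_sphere (orthogonal_comp V) = distr (Haar_fix V) borel (\<lambda>T. T *v e)"
  unfolding unif_sphere_eq_The
  using is_unif_sphere_distr_Haar_fix[OF V is_Haar_fix_Haar_fix[OF V] e]
    is_unif_sphere_unique[OF V is_Haar_fix_Haar_fix[OF V] e]
  by (rule the_equality)

section \<open>Characterisations of O_n(V)-invariant laws\<close>

lemma borel_measurable_matrix_apply_pair:
  "(\<lambda>(T :: real^'n^'n, v). T *v v) \<in> borel_measurable (borel \<Otimes>\<^sub>M borel)"
  unfolding case_prod_beta' by (intro borel_measurable_matrix_vector_mult measurable_fst measurable_snd)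

lemma invariant_iff_Haar_fix_average:
  fixes V :: "(real^'n) set"
  assumes \<eta>: "is_Haar_fix V \<eta>" and Y: "sets Y = sets borel" "prob_space Y"
  shows "(\<forall>S\<in>orth_fix V. distr Y borel ((*v) S) = Y)
    \<longleftrightarrow> distr (\<eta> \<Otimes>\<^sub>M Y) borel (\<lambda>(T, v). T *v v) = Y"
proof
  note \<eta>D = is_Haar_fixD[OF \<eta>]
  assume "\<forall>S\<in>orth_fix V. distr Y borel ((*v) S) = Y"
  then have "AE T in \<eta>. distr Y borel (\<lambda>v. T *v v) = Y"
    using \<eta>D(3) by (auto elim!: AE_mp)
  then show "distr (\<eta> \<Otimes>\<^sub>M Y) borel (\<lambda>(T, v). T *v v) = Y"
    by (intro distr_pair_measure_eq_if_AE_sections[OF \<eta>D(1,2) Y Y(1) borel_measurable_matrix_apply_pair])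
      simp
next
  note \<eta>D = is_Haar_fixD[OF \<eta>]
  let ?\<Phi> = "distr (\<eta> \<Otimes>\<^sub>M Y) borel (\<lambda>(T, v). T *v v)"
  assume average: "?\<Phi> = Y"
  show "\<forall>S\<in>orth_fix V. distr Y borel ((*v) S) = Y"
  proof
    fix S assume S: "S \<in> orth_fix V"
    have "distr ?\<Phi> borel ((*v) S) = distr (\<eta> \<Otimes>\<^sub>M Y) borel (\<lambda>(T, v). (S ** T) *v v)"
      using measurable_pair_if_sets_eq_borel[OF \<eta>D(1) Y(1) borel_measurable_matrix_apply_pair]
      by (subst distr_distr) (auto simp: comp_def case_prod_beta' matrix_vector_mul_assoc)
    also have "\<dots> = ?\<Phi>"
      using distr_pair_measure_fst_invariant[OF \<eta>D(1,2) Y borel_measurable_matrix_apply_pair _ \<eta>D(4)[OF S]]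
      by simp
    finally show "distr Y borel ((*v) S) = Y"
      by (simp add: average)
  qed
qed

lemma radial_mixture_eq_Haar_fix_average:
  fixes V :: "(real^'n) set"
  assumes V: "subspace V" and \<eta>: "is_Haar_fix V \<eta>" and e: "e \<in> orthogonal_comp V" "norm e = 1"
    and Y: "sets Y = sets borel" "prob_space Y"
  shows "distr (Y \<Otimes>\<^sub>M distr \<eta> borel (\<lambda>T. T *v e)) borel
      (\<lambda>(v, u). orth_proj V v + norm (v - orth_proj V v) *\<^sub>R u)
    = distr (\<eta> \<Otimes>\<^sub>M Y) borel (\<lambda>(T, v). T *v v)"
proof -
  note \<eta>D = is_Haar_fixD[OF \<eta>]
  let ?\<sigma> = "distr \<eta> borel (\<lambda>T. T *v e)"
  have apply_e: "(\<lambda>T. T *v e) \<in> borel_measurable \<eta>"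
    by (intro measurable_if_sets_eq_borel[OF \<eta>D(1)]) measurable
  have \<sigma>: "sets ?\<sigma> = sets borel" "prob_space ?\<sigma>"
    using prob_space.prob_space_distr[OF \<eta>D(2) apply_e] by simp_all
  have "orth_proj V \<in> borel_measurable borel"
    by (rule linear_imp_borel_measurable[OF linear_orth_proj[OF V]])
  then have radial: "(\<lambda>(v, u). orth_proj V v + norm (v - orth_proj V v) *\<^sub>R u)
      \<in> borel_measurable (borel \<Otimes>\<^sub>M borel)"
    by measurable
  have apply_vT: "(\<lambda>(v, T :: real^'n^'n). T *v v) \<in> borel_measurable (borel \<Otimes>\<^sub>M borel)"
    unfolding case_prod_beta' by (intro borel_measurable_matrix_vector_mult measurable_fst measurable_snd)
  have "distr (Y \<Otimes>\<^sub>M ?\<sigma>) borel (\<lambda>(v, u). orth_proj V v + norm (v - orth_proj V v) *\<^sub>R u)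
      = distr (Y \<Otimes>\<^sub>M \<eta>) borel (\<lambda>(v, T). T *v v)"
    by (intro distr_pair_measure_cong_AE[OF Y \<sigma> \<eta>D(1,2) radial apply_vT] AE_I2)
      (simp add: distr_Haar_fix_orbit[OF V \<eta> e, symmetric])
  also have "\<dots> = distr (\<eta> \<Otimes>\<^sub>M Y) borel (\<lambda>(T, v). T *v v)"
    using distr_pair_measure_swap[OF \<eta>D(1,2) Y borel_measurable_matrix_apply_pair] by simp
  finally show ?thesis .
qed

theorem lemma2:
  fixes N :: "'i set" and x :: "'i \<Rightarrow> real^'n"
    and M :: "'a measure" and y :: "'a \<Rightarrow> real^'n"
  assumes "finite N"
    and "inj_on x N" and "independent (x ` N)"
    and "card N < CARD('n) - 1"
    and "prob_space M"
    and "y \<in> borel_measurable M"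
  defines "V \<equiv> span (x ` N)"
  shows "((\<forall>S\<in>orth_fix V. distr M borel (\<lambda>\<omega>. S *v y \<omega>) = distr M borel y)
          \<longleftrightarrow>
          distr (Haar_fix V \<Otimes>\<^sub>M distr M borel y) borel (\<lambda>(T, v). T *v v)
            = distr M borel y)
      \<and> ((\<forall>S\<in>orth_fix V. distr M borel (\<lambda>\<omega>. S *v y \<omega>) = distr M borel y)
          \<longleftrightarrow>
          distr M borel y
            = distr (distr M borel y \<Otimes>\<^sub>M unif_sphere (orthogonal_comp V)) borel
                (\<lambda>(v, u). orth_proj V v + norm (v - orth_proj V v) *\<^sub>R u))"
proof -
  define Y where "Y = distr M borel y"
  have V: "subspace V"
    unfolding V_def by (rule subspace_span)
  \<comment> \<open>only \<open>dim V < n\<close> is needed, which is weaker than the hypothesis \<open>p < n - 1\<close>\<close>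
  have "dim V < CARD('n)"
    using assms(2-4) by (simp add: V_def dim_eq_card_independent card_image)
  then obtain e where e: "e \<in> orthogonal_comp V" "norm e = 1"
    using unit_vector_in_orthogonal_comp[OF V] subspace_ne_UNIV_iff_dim_less[OF V] by metis
  have Y: "sets Y = sets borel" "prob_space Y"
    using prob_space.prob_space_distr[OF assms(5,6)] by (simp_all add: Y_def)
  have "distr M borel (\<lambda>\<omega>. S *v y \<omega>) = distr Y borel ((*v) S)" for S :: "real^'n^'n"
    using assms(6) by (simp add: Y_def distr_distr comp_def linear_imp_borel_measurable)
  then have "(\<forall>S\<in>orth_fix V. distr M borel (\<lambda>\<omega>. S *v y \<omega>) = Y)
      \<longleftrightarrow> distr (Haar_fix V \<Otimes>\<^sub>M Y) borel (\<lambda>(T, v). T *v v) = Y"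
    using invariant_iff_Haar_fix_average[OF is_Haar_fix_Haar_fix[OF V] Y] by simp
  moreover have "distr (Y \<Otimes>\<^sub>M unif_sphere (orthogonal_comp V)) borel
      (\<lambda>(v, u). orth_proj V v + norm (v - orth_proj V v) *\<^sub>R u)
    = distr (Haar_fix V \<Otimes>\<^sub>M Y) borel (\<lambda>(T, v). T *v v)"
    unfolding unif_sphere_eq_distr_Haar_fix[OF V e]
    by (rule radial_mixture_eq_Haar_fix_average[OF V is_Haar_fix_Haar_fix[OF V] e Y])
  ultimately show ?thesis
    unfolding Y_def by auto
qed

end
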